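(* Consider the transformation $(p,q)\mapsto(a,b)=\left(\frac{|p-q|-|p+q|}2,\ |p|-|q|\right)$, which identifies $\mathbb{Z}^2/(-1)$ with $\mathbb{Z}^2$. Its inverse transformation $(a,b)\mapsto\pm(p,q)$ is given by $$\pm(p,q)=\begin{cases}(|a|+b,\,-a), & \text{if } b\ge0,\\ (a,\,b-|a|), & \text{if } b\le0.\end{cases}$$
   Context: $\mathbb{Z}^2/(-1)$ is the quotient of $\mathbb{Z}^2$ by the involution $(p,q)\mapsto(-p,-q)$; the formula gives $(p,q)$ up to simultaneous change of sign (for $b=0$ the two lines agree up to sign). (In the paper, $(p,q)$ are homological torus coordinates of a multi-curve in a one-holed torus double covering a $3$-marked disc, and $(a,b)$ are its Dynnikov coordinates.) *)

theory Defs
  imports Complex_Main "HOL-Library.Product_Plus"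
begin

definition pm_eq :: "int \<times> int \<Rightarrow> int \<times> int \<Rightarrow> bool" where
  "pm_eq x y \<longleftrightarrow> x = y \<or> x = - y"

quotient_type int2_pm = "int \<times> int" / pm_eq
  morphisms rep_pm pm
proof (rule equivpI)
  show "reflp pm_eq" by (simp add: reflp_def pm_eq_def)
  show "symp pm_eq" by (auto simp: symp_def pm_eq_def)
  show "transp pm_eq" by (auto simp: transp_def pm_eq_def)
qed

text \<open>The numerator \<open>\<bar>p - q\<bar> - \<bar>p + q\<bar>\<close> is always even, so the integer division is exact.\<close>

definition dynnikov_pair :: "int \<times> int \<Rightarrow> int \<times> int" where
  "dynnikov_pair = (\<lambda>(p, q). ((\<bar>p - q\<bar> - \<bar>p + q\<bar>) div 2, \<bar>p\<bar> - \<bar>q\<bar>))"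

lift_definition dynnikov :: "int2_pm \<Rightarrow> int \<times> int" is dynnikov_pair
proof -
  fix x y :: "int \<times> int"
  assume "pm_eq x y"
  moreover have "dynnikov_pair (- y) = dynnikov_pair y"
  proof (cases y)
    case (Pair p q)
    have "\<bar>q - p\<bar> = \<bar>p - q\<bar>" "\<bar>- q - p\<bar> = \<bar>p + q\<bar>" by arith+
    then show ?thesis by (simp add: Pair dynnikov_pair_def)
  qed
  ultimately show "dynnikov_pair x = dynnikov_pair y"
    by (auto simp: pm_eq_def)
qed

end

theory Submission
  imports Defs
begin

text \<open>The identity \<open>\<bar>p - q\<bar> - \<bar>p + q\<bar> = - 2 * sgn (p * q) * min
  \<bar>p\<bar> \<bar>q\<bar>\<close> explains everything: \<open>\<bar>a\<bar>\<close> is the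
  smaller of \<open>\<bar>p\<bar>\<close> and \<open>\<bar>q\<bar>\<close>, the sign of
  \<open>b\<close> tells which one is smaller, \<open>\<bar>b\<bar>\<close> is their difference, and
  the sign of \<open>a\<close> is opposite to that of \<open>p * q\<close>. This fixes both absolute
  values and the relative sign, hence the pair up to a common sign.
  \<open>dynnikov_pm_nonneg\<close> and \<open>dynnikov_pm_nonpos\<close> show that the formulas
  give preimages; the two \<open>pm_eq_if_dynnikov\<close> lemmas show that there are no
  others.\<close>

lemma pm_eq_iff: "pm x = pm y \<longleftrightarrow> x = y \<or> x = - y"
  using int2_pm.abs_eq_iff[of x y] by (simp add: pm_eq_def)

text \<open>Parity makes the division exact. Clearing it leaves linear arithmetic with absolute
  values, which decision procedures settle by cases on signs.\<close>

lemma dynnikov_pm_eq_iff: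
  "dynnikov (pm (p, q)) = (a, b) \<longleftrightarrow> 2 * a = \<bar>p - q\<bar> - \<bar>p + q\<bar> \<and> b = \<bar>p\<bar> - \<bar>q\<bar>"
proof -
  have "even (\<bar>p - q\<bar> - \<bar>p + q\<bar>)"
    by simp
  then show ?thesis
    by (auto simp: dynnikov.abs_eq dynnikov_pair_def)
qed

lemma dynnikov_pm_nonneg:
  assumes "b \<ge> 0"
  shows "dynnikov (pm (\<bar>a\<bar> + b, - a)) = (a, b)"
  unfolding dynnikov_pm_eq_iff using assms by arith

lemma dynnikov_pm_nonpos:
  assumes "b \<le> 0"
  shows "dynnikov (pm (a, b - \<bar>a\<bar>)) = (a, b)"
  unfolding dynnikov_pm_eq_iff using assms by arith

lemma pm_eq_if_dynnikov_nonneg: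
  assumes "dynnikov (pm (p, q)) = (a, b)" "b \<ge> 0"
  shows "pm (p, q) = pm (\<bar>a\<bar> + b, - a)"
proof -
  have "2 * a = \<bar>p - q\<bar> - \<bar>p + q\<bar>" "b = \<bar>p\<bar> - \<bar>q\<bar>"
    using assms(1) by (simp_all add: dynnikov_pm_eq_iff)
  \<comment> \<open>Here \<open>\<bar>q\<bar> \<le> \<bar>p\<bar>\<close>, so
    \<open>\<bar>q\<bar> = \<bar>a\<bar>\<close>. The disjuncts are the cases
    \<open>p \<ge> 0\<close> and \<open>p \<le> 0\<close>.\<close>
  then have "p = \<bar>a\<bar> + b \<and> q = - a \<or> p = - (\<bar>a\<bar> + b) \<and> q = a"
    using assms(2) by (smt (verit))
  then show ?thesis
    by (auto simp: pm_eq_iff)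
qed

lemma pm_eq_if_dynnikov_nonpos:
  assumes "dynnikov (pm (p, q)) = (a, b)" "b \<le> 0"
  shows "pm (p, q) = pm (a, b - \<bar>a\<bar>)"
proof -
  have "2 * a = \<bar>p - q\<bar> - \<bar>p + q\<bar>" "b = \<bar>p\<bar> - \<bar>q\<bar>"
    using assms(1) by (simp_all add: dynnikov_pm_eq_iff)
  \<comment> \<open>Now \<open>\<bar>p\<bar> = \<bar>a\<bar>\<close>, and the sign of
    \<open>q\<close> separates the cases: \<open>p = a\<close> belongs to
    \<open>q \<le> 0\<close>.\<close>
  then have "p = a \<and> q = b - \<bar>a\<bar> \<or> p = - a \<and> q = - (b - \<bar>a\<bar>)"
    using assms(2) by (smt (verit))
  then show ?thesis
    by (auto simp: pm_eq_iff)
qed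

text \<open>Two classes with the same image \<open>(a, b)\<close> both equal the one class that the
  formula for the sign of \<open>b\<close> yields.\<close>

lemma inj_dynnikov: "inj dynnikov"
proof (rule injI)
  fix X Y
  assume eq: "dynnikov X = dynnikov Y"
  obtain p q where X: "X = pm (p, q)"
    by (metis Quotient_int2_pm Quotient_abs_rep surj_pair)
  obtain r s where Y: "Y = pm (r, s)"
    by (metis Quotient_int2_pm Quotient_abs_rep surj_pair)
  obtain a b where Yab: "dynnikov Y = (a, b)"
    by fastforce
  show "X = Y"
  proof (cases "b \<ge> 0")
    case True
    then show ?thesis
      using eq Yab X Y by (metis pm_eq_if_dynnikov_nonneg)
  next
    case False
    then show ?thesis
      using eq Yab X Y by (metis pm_eq_if_dynnikov_nonpos linear)
  qed
qed

theorem proposition4p5: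
  shows "(\<forall>p q :: int.
            real_of_int (fst (dynnikov (pm (p, q)))) =
              (\<bar>real_of_int p - real_of_int q\<bar> - \<bar>real_of_int p + real_of_int q\<bar>) / 2 \<and>
            snd (dynnikov (pm (p, q))) = \<bar>p\<bar> - \<bar>q\<bar>) \<and>
         bij dynnikov \<and>
         (\<forall>a b :: int.
            (b \<ge> 0 \<longrightarrow> inv dynnikov (a, b) = pm (\<bar>a\<bar> + b, - a)) \<and>
            (b \<le> 0 \<longrightarrow> inv dynnikov (a, b) = pm (a, b - \<bar>a\<bar>)))"
proof (intro conjI allI impI)
  fix p q :: int
  obtain a b where ab: "dynnikov (pm (p, q)) = (a, b)"
    by fastforce
  then have "2 * a = \<bar>p - q\<bar> - \<bar>p + q\<bar>" and b: "b = \<bar>p\<bar> - \<bar>q\<bar>"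
    by (simp_all add: dynnikov_pm_eq_iff)
  then have "real_of_int (2 * a) = real_of_int (\<bar>p - q\<bar> - \<bar>p + q\<bar>)"
    by simp
  then show "real_of_int (fst (dynnikov (pm (p, q)))) =
      (\<bar>real_of_int p - real_of_int q\<bar> - \<bar>real_of_int p + real_of_int q\<bar>) / 2"
    using ab by simp
  show "snd (dynnikov (pm (p, q))) = \<bar>p\<bar> - \<bar>q\<bar>"
    using ab b by simp
next
  have "\<exists>X. y = dynnikov X" for y
    using dynnikov_pm_nonneg dynnikov_pm_nonpos by (metis linear surj_pair)
  then show "bij dynnikov"
    using inj_dynnikov by (simp add: bij_def surj_def)
next
  fix a b :: int
  assume "b \<ge> 0"
  \<comment> \<open>By injectivity, exhibiting one preimage determines the value of
    \<open>inv\<close>.\<close>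
  then show "inv dynnikov (a, b) = pm (\<bar>a\<bar> + b, - a)"
    by (intro inv_f_eq inj_dynnikov dynnikov_pm_nonneg)
next
  fix a b :: int
  assume "b \<le> 0"
  then show "inv dynnikov (a, b) = pm (a, b - \<bar>a\<bar>)"
    by (intro inv_f_eq inj_dynnikov dynnikov_pm_nonpos)
qed

end
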